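(* Let $U$ be a real Hilbert space, $\mathcal{F}:U\to\mathbb{R}$ and $\mathcal{G}:U\to\mathbb{R}\cup\{\infty\}$ ($\mathcal{G}$ not necessarily convex), and assume that $\mathcal{F}$ is convex and weakly lower semicontinuous, $\mathcal{G}$ is proper and non-negative, and $\mathcal{F}+\mathcal{G}^{**}$ is radially unbounded. Let $\mathcal{J}(u)=\mathcal{F}(u)+\mathcal{G}(u)$ and let $(\bar u,\bar p)\in U\times U$ satisfy $$-\bar p\in\partial\mathcal{F}(\bar u),\qquad \bar u\in\partial\mathcal{G}^*(\bar p).$$ Then $$\mathcal{J}(\bar u)\le\mathcal{J}(u)+\delta(\bar u,\bar p)\quad\text{for all }u\in U,$$ where $\delta(u,p):=\mathcal{G}(u)+\mathcal{G}^*(p)-\langle p,u\rangle$.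
   Context: $U$ is identified with its dual. $\mathcal{G}^*:U\to\mathbb{R}\cup\{\infty\}$, $\mathcal{G}^*(p)=\sup_{u\in U}\langle u,p\rangle-\mathcal{G}(u)$, is the Fenchel conjugate of $\mathcal{G}$ and $\mathcal{G}^{**}=(\mathcal{G}^* )^*$ is its biconjugate. $\partial$ denotes the convex subdifferential. A functional $\mathcal{K}$ is radially unbounded if $\mathcal{K}(u)\to\infty$ whenever $\|u\|_U\to\infty$. Inequalities are understood in $\mathbb{R}\cup\{\infty\}$. *)

theory Defs
  imports "HOL-Analysis.Analysis"
begin

text \<open>
  A real Hilbert space is a type of sort \<open>{real_inner, complete_space}\<close>; functionals with values in
  the reals extended by infinity are maps into \<^typ>\<open>ereal\<close>, where properness rules out \<open>-\<infinity>\<close>.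
\<close>

text \<open>The space being identified with its dual, the functionals are the maps \<open>\<lambda>u. u \<bullet> p\<close>.\<close>

definition weak_topology :: "'a::real_inner topology" where
  "weak_topology = topology_generated_by {(\<lambda>u. u \<bullet> p) -` S | p S. open (S :: real set)}"

definition weakly_lsc :: "('a::real_inner \<Rightarrow> real) \<Rightarrow> bool" where
  "weakly_lsc f \<longleftrightarrow> (\<forall>c. openin weak_topology {u. c < f u})"

definition proper_fun :: "('a \<Rightarrow> ereal) \<Rightarrow> bool" where
  "proper_fun f \<longleftrightarrow> (\<forall>u. f u \<noteq> -\<infinity>) \<and> (\<exists>u. f u \<noteq> \<infinity>)"

text \<open>Points with \<open>f u = \<infinity>\<close> contribute \<open>-\<infinity>\<close> to the supremum, as usual.\<close>

definition fenchel_conj :: "('a::real_inner \<Rightarrow> ereal) \<Rightarrow> 'a \<Rightarrow> ereal" where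
  "fenchel_conj f p = (SUP u. ereal (u \<bullet> p) - f u)"

definition biconj :: "('a::real_inner \<Rightarrow> ereal) \<Rightarrow> 'a \<Rightarrow> ereal" where
  "biconj f = fenchel_conj (fenchel_conj f)"

text \<open>The subdifferential is empty outside the effective domain of \<open>f\<close>.\<close>

definition subdiff :: "('a::real_inner \<Rightarrow> ereal) \<Rightarrow> 'a \<Rightarrow> 'a set" where
  "subdiff f u = {p. \<bar>f u\<bar> \<noteq> \<infinity> \<and> (\<forall>v. f u + ereal (p \<bullet> (v - u)) \<le> f v)}"

definition radially_unbounded :: "('a::real_normed_vector \<Rightarrow> ereal) \<Rightarrow> bool" where
  "radially_unbounded K \<longleftrightarrow> (K \<longlongrightarrow> \<infinity>) at_infinity"

definition objective :: "('a \<Rightarrow> real) \<Rightarrow> ('a \<Rightarrow> ereal) \<Rightarrow> 'a \<Rightarrow> ereal" where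
  "objective F G u = ereal (F u) + G u"

definition duality_gap :: "('a::real_inner \<Rightarrow> ereal) \<Rightarrow> 'a \<Rightarrow> 'a \<Rightarrow> ereal" where
  "duality_gap G u p = G u + fenchel_conj G p - ereal (p \<bullet> u)"

end

theory Submission
  imports Defs
begin

text \<open>
  The inequality adds up two affine lower bounds with opposite slopes. The inclusion
  \<open>- pbar \<in> \<partial>F(ubar)\<close> says that \<open>F + \<langle>pbar, \<cdot>\<rangle>\<close> is minimal at \<open>ubar\<close>, and the Fenchel-Young
  inequality says that \<open>G - \<langle>pbar, \<cdot>\<rangle>\<close> is bounded below by \<open>- G\<^sup>*(pbar)\<close>. In the sum the linear
  terms cancel, so \<open>F ubar + \<langle>pbar, ubar\<rangle> - G\<^sup>*(pbar)\<close> is a lower bound for \<open>F + G\<close>, and this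
  number falls short of \<open>F ubar + G ubar\<close> by exactly the gap \<open>\<delta>(ubar, pbar)\<close>. The inclusion
  \<open>ubar \<in> \<partial>G\<^sup>*(pbar)\<close> makes \<open>G\<^sup>*(pbar)\<close> finite, without which this arithmetic would run into
  \<open>\<infinity> - \<infinity>\<close>.
\<close>

text \<open>Stated without a sum of \<open>f u\<close> and its conjugate, so that infinite values do no harm.\<close>

lemma fenchel_young: "ereal (u \<bullet> p) - f u \<le> fenchel_conj f p"
  unfolding fenchel_conj_def by (rule SUP_upper) simp

theorem lemma2p2:
  fixes F :: "'a::{real_inner, complete_space} \<Rightarrow> real"
    and G :: "'a \<Rightarrow> ereal"
    and ubar pbar :: 'a
  assumes "convex_on UNIV F"
    and "weakly_lsc F"
    and "proper_fun G"
    and "\<And>u. 0 \<le> G u"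
    and "radially_unbounded (\<lambda>u. ereal (F u) + biconj G u)"
    and "- pbar \<in> subdiff (\<lambda>u. ereal (F u)) ubar"
    and "ubar \<in> subdiff (fenchel_conj G) pbar"
  shows "\<forall>u. objective F G ubar \<le> objective F G u + duality_gap G ubar pbar"
proof
  fix u
  from assms(7) obtain g where g: "fenchel_conj G pbar = ereal g"
    by (auto simp: subdiff_def)
  from assms(6) have "ereal (F ubar) + ereal (- pbar \<bullet> (u - ubar)) \<le> ereal (F u)"
    unfolding subdiff_def by blast
  then have F_bound: "F ubar + pbar \<bullet> ubar \<le> F u + pbar \<bullet> u"
    by (simp add: inner_diff_right)
  have young: "ereal (u \<bullet> pbar) - G u \<le> ereal g"
    using fenchel_young[of u pbar G] g by simp
  show "objective F G ubar \<le> objective F G u + duality_gap G ubar pbar"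
    unfolding objective_def duality_gap_def g
    using assms(4)[of u] assms(4)[of ubar] F_bound young
    by (cases "G u"; cases "G ubar") (auto simp: inner_commute)
qed

end
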